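(* Let $N\ge1$ and let $g$ be a random vector in $\mathbb{C}^N$ distributed according to the complex standard normal distribution. Then, with probability $1$, $\langle g,g_\lambda\rangle\neq0$ for all $\lambda\in\mathbb{Z}_N^2$.
   Context: Vectors in $\mathbb{C}^N$ are indexed by $\mathbb{Z}_N=\mathbb{Z}/N\mathbb{Z}$, and $\omega=e^{2\pi i/N}$. The scalar product is $\langle x,y\rangle=\sum_{j\in\mathbb{Z}_N}\overline{x(j)}\,y(j)$. Translations and modulations are $(T_px)(n)=x(n-p)$ and $(M_\ell x)(n)=\omega^{\ell n}x(n)$ for $p,\ell\in\mathbb{Z}_N$. For $\lambda=(p,\ell)\in\mathbb{Z}_N^2$ put $g_\lambda=M_\ell T_pg$. Complex standard normal distribution on $\mathbb{C}^N$: the real and imaginary parts of the $N$ entries are $2N$ independent real standard normal random variables. *)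

theory Defs
  imports "HOL-Probability.Probability"
begin

text \<open>
  The residues modulo \<open>N\<close> are represented by \<open>{0..<N}\<close>; a vector in \<open>\<complex>\<^sup>N\<close> is a function
  \<open>int \<Rightarrow> complex\<close> of which only the values on \<open>{0..<N}\<close> are used.
\<close>

definition residue_set :: "nat \<Rightarrow> int set" where
  "residue_set N = {0..<int N}"

definition unit_root :: "nat \<Rightarrow> complex" where
  "unit_root N = exp (2 * complex_of_real pi * \<i> / of_nat N)"

definition hermitian_product :: "nat \<Rightarrow> (int \<Rightarrow> complex) \<Rightarrow> (int \<Rightarrow> complex) \<Rightarrow> complex" where
  "hermitian_product N x y = (\<Sum>j\<in>residue_set N. cnj (x j) * y j)"

definition translation :: "nat \<Rightarrow> int \<Rightarrow> (int \<Rightarrow> complex) \<Rightarrow> (int \<Rightarrow> complex)" where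
  "translation N p x = (\<lambda>n. x ((n - p) mod int N))"

definition modulation :: "nat \<Rightarrow> int \<Rightarrow> (int \<Rightarrow> complex) \<Rightarrow> (int \<Rightarrow> complex)" where
  "modulation N l x = (\<lambda>n. unit_root N powi (l * n) * x n)"

definition time_freq_shift :: "nat \<Rightarrow> int \<times> int \<Rightarrow> (int \<Rightarrow> complex) \<Rightarrow> (int \<Rightarrow> complex)" where
  "time_freq_shift N lam g = modulation N (snd lam) (translation N (fst lam) g)"

text \<open>
  The index set \<open>residue_set N \<times> UNIV\<close> has \<open>2 * N\<close> elements: \<open>(j, True)\<close> stands for the real
  part and \<open>(j, False)\<close> for the imaginary part of the entry \<open>j\<close>.
\<close>

definition real_coordinate :: "int \<times> bool \<Rightarrow> (int \<Rightarrow> complex) \<Rightarrow> real" where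
  "real_coordinate i x = (if snd i then Re (x (fst i)) else Im (x (fst i)))"

definition complex_std_normal_vector ::
    "'a measure \<Rightarrow> nat \<Rightarrow> ('a \<Rightarrow> int \<Rightarrow> complex) \<Rightarrow> bool" where
  "complex_std_normal_vector M N g \<longleftrightarrow>
     prob_space.indep_vars M (\<lambda>_. borel) (\<lambda>i \<xi>. real_coordinate i (g \<xi>))
       (residue_set N \<times> (UNIV :: bool set)) \<and>
     (\<forall>i \<in> residue_set N \<times> (UNIV :: bool set).
       distributed M lborel (\<lambda>\<xi>. real_coordinate i (g \<xi>)) std_normal_density)"

end

theory Submission
  imports Defs
begin

text \<open>
  For \<open>\<lambda> = (p, \<ell>)\<close> the number \<open>A(z) = \<langle>z, M\<^sub>\<ell> T\<^sub>p z\<rangle>\<close> is a quadratic polynomial in the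
  \<open>2N\<close> real coordinates of \<open>z\<close>, and a polynomial that is not identically zero vanishes only on
  a null set.  Because \<open>A\<close> has degree two, the general theory of such null sets can be replaced
  by two steps that each move a single real coordinate.

  Moving the real part of \<open>z\<^sub>0\<close> by \<open>s\<close> changes \<open>A(z)\<close> into \<open>A(z) + s L(z) + s\<^sup>2 [p = 0]\<close> with
  \<open>L(z) = z(-p) + \<omega>\<^bsup>\<ell>p\<^esup> cnj (z(p))\<close> (lemma \<open>ambiguity_perturb_origin\<close>).  Wherever this
  polynomial in \<open>s\<close> is nonconstant it has finitely many roots, which a Gaussian variable avoids
  almost surely.  So it suffices that \<open>L(z) \<noteq> 0\<close> almost surely.  The map \<open>L\<close> is
  real-linear, and moving \<open>z\<^sub>p\<close> by \<open>s d\<close> with \<open>d \<in> {1, \<i>}\<close> adds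
  \<open>s ([2p = 0] d + \<omega>\<^bsup>\<ell>p\<^esup> cnj d)\<close> to it.  The coefficient of \<open>s\<close> can cancel for one of the
  two directions (when \<open>2p = 0\<close> in \<open>\<int>\<^sub>N\<close>), but never for both
  (lemma \<open>exists_real_direction\<close>), so the same root-counting argument applies in a good
  direction.

  The passage from almost every value of one coordinate to almost every vector is
  Fubini's theorem, in the form that resampling one coordinate of a product probability measure
  does not change its law (lemma \<open>AE_PiM_resample\<close>).  Independence of the coordinates
  identifies their joint law with such a product (lemma \<open>distr_real_coordinates\<close>).
\<close>

section \<open>Resampling one coordinate of a product measure\<close>

text \<open>
  The quantified form avoids splitting the index set: the outer point \<open>x\<close> keeps a \<open>k\<close>-th
  coordinate, which the update overwrites.  Integrating out the overwritten value costs
  nothing since \<open>M k\<close> has mass one, so replacing it by an independent copy preserves the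
  product law.
\<close>

lemma (in product_prob_space) AE_PiM_resample:
  assumes "finite I" "k \<in> I"
    and meas: "{x \<in> space (PiM I M). P x} \<in> sets (PiM I M)"
    and ae: "AE x in PiM I M. AE t in M k. P (x(k := t))"
  shows "AE x in PiM I M. P x"
proof -
  define J where "J = I - {k}"
  have I: "I = insert k J" and J: "finite J" "k \<notin> J"
    using assms(1,2) by (auto simp: J_def)
  define f :: "_ \<Rightarrow> ennreal" where "f = indicator {x \<in> space (PiM I M). \<not> P x}"
  have bad: "{x \<in> space (PiM I M). \<not> P x} \<in> sets (PiM I M)"
    using sets.sets_Collect_neg[OF meas] .
  have f [measurable]: "f \<in> borel_measurable (PiM I M)"
    unfolding f_def using bad by (rule borel_measurable_indicator)
  have upd [measurable]: "(\<lambda>z. (fst z)(k := snd z)) \<in> PiM I M \<Otimes>\<^sub>M M k \<rightarrow>\<^sub>M PiM I M"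
    using assms(2) by (intro measurable_fun_upd[where J = I]) auto
  define h where "h = (\<lambda>x. \<integral>\<^sup>+t. f (x(k := t)) \<partial>M k)"
  have h [measurable]: "h \<in> borel_measurable (PiM I M)"
    unfolding h_def
    using measurable_compose[OF upd f]
    by (intro sigma_finite_measure.borel_measurable_nn_integral[OF sigma_finite_measures])
      (simp add: case_prod_beta')
  \<comment> \<open>The function \<open>h\<close> ignores the coordinate \<open>k\<close>, so it has the same integral over
    \<open>PiM J M\<close> and over \<open>PiM I M\<close>; the hypothesis makes it vanish almost everywhere.\<close>
  have "integral\<^sup>N (PiM I M) f = (\<integral>\<^sup>+x. h x \<partial>PiM J M)"
    using product_nn_integral_insert[OF J, of f] f unfolding I h_def by simp
  also have "\<dots> = (\<integral>\<^sup>+x. (\<integral>\<^sup>+s. h (x(k := s)) \<partial>M k) \<partial>PiM J M)"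
    by (simp add: h_def prob_space.emeasure_space_1[OF prob_space])
  also have "\<dots> = integral\<^sup>N (PiM I M) h"
    using product_nn_integral_insert[OF J, of h] h unfolding I by simp
  also have "\<dots> = 0"
  proof -
    have "AE x in PiM I M. h x = 0"
      using ae
    proof (rule AE_mp, intro AE_I2 impI)
      fix x assume "AE t in M k. P (x(k := t))"
      then have "AE t in M k. f (x(k := t)) = 0"
        by (rule AE_mp) (auto intro!: AE_I2 simp: f_def)
      then show "h x = 0"
        unfolding h_def by (subst nn_integral_cong_AE[where v = "\<lambda>_. 0"]) auto
    qed
    then show ?thesis by (simp add: nn_integral_0_iff_AE)
  qed
  finally have "AE x in PiM I M. f x = 0"
    by (simp add: nn_integral_0_iff_AE)
  then show ?thesis
    by (rule AE_mp) (auto intro!: AE_I2 simp: f_def indicator_eq_0_iff)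
qed

section \<open>Roots of polynomials in a Gaussian variable\<close>

definition std_gaussian :: "real measure" where
  "std_gaussian = density lborel std_normal_density"

lemma sets_std_gaussian [measurable_cong, simp]: "sets std_gaussian = sets borel"
  by (simp add: std_gaussian_def)

lemma prob_space_std_gaussian: "prob_space std_gaussian"
  unfolding std_gaussian_def by (rule prob_space_normal_density) simp

text \<open>
  The polynomial is centred at the old value \<open>r\<close> of the coordinate, since the expansions below are
  in terms of the increment \<open>t - r\<close>.
\<close>

lemma AE_std_gaussian_quadratic_nonzero:
  fixes a b c :: complex
  assumes "b \<noteq> 0 \<or> c \<noteq> 0"
  shows "AE t in std_gaussian. a + of_real (t - r) * b + of_real ((t - r)\<^sup>2) * c \<noteq> 0"
proof -
  let ?p = "[:a, b, c:] \<circ>\<^sub>p [:- of_real r, 1:]"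
  have "degree ?p = degree [:a, b, c:]"
    by (simp only: degree_pcompose) simp
  also have "\<dots> > 0"
    using assms by auto
  finally have "?p \<noteq> 0"
    by (metis degree_0 less_irrefl)
  then have "finite {z. poly ?p z = 0}" by (rule poly_roots_finite)
  then have "finite (of_real -` {z. poly ?p z = 0} :: real set)"
    by (rule finite_vimageI) (simp add: inj_def)
  then have "AE t in lborel. t \<notin> (of_real -` {z. poly ?p z = 0} :: real set)"
    by (intro AE_not_in finite_imp_null_set_lborel)
  then have "AE t in lborel. a + of_real (t - r) * b + of_real ((t - r)\<^sup>2) * c \<noteq> 0"
    by (rule AE_mp) (auto intro!: AE_I2 simp: poly_pcompose algebra_simps power2_eq_square)
  then show ?thesis
    unfolding std_gaussian_def by (subst AE_density) auto
qed

section \<open>The ambiguity function under a change of one entry\<close>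

definition ambiguity :: "nat \<Rightarrow> int \<times> int \<Rightarrow> (int \<Rightarrow> complex) \<Rightarrow> complex" where
  "ambiguity N lam z = hermitian_product N z (time_freq_shift N lam z)"

text \<open>The derivative of the ambiguity function in the direction of the real part of entry \<open>0\<close>.\<close>

definition ambiguity_slope :: "nat \<Rightarrow> int \<times> int \<Rightarrow> (int \<Rightarrow> complex) \<Rightarrow> complex" where
  "ambiguity_slope N lam z =
     z ((- fst lam) mod int N) + unit_root N powi (snd lam * fst lam) * cnj (z (fst lam))"

definition perturb :: "(int \<Rightarrow> complex) \<Rightarrow> int \<Rightarrow> complex \<Rightarrow> int \<Rightarrow> complex" where
  "perturb z k s = (\<lambda>j. z j + (if j = k then s else 0))"

lemma unit_root_powi_nonzero: "unit_root N powi m \<noteq> 0"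
  by (simp add: unit_root_def)

lemma residue_shift_eq_zero_iff:
  assumes "N \<ge> 1" "p \<in> residue_set N" "j \<in> residue_set N"
  shows "(j - p) mod int N = 0 \<longleftrightarrow> j = p"
proof -
  have "(j - p) mod int N = 0 \<longleftrightarrow> j mod int N = p mod int N"
    by (simp add: mod_eq_dvd_iff mod_eq_0_iff_dvd)
  also have "\<dots> \<longleftrightarrow> j = p"
    using assms by (simp add: residue_set_def)
  finally show ?thesis .
qed

text \<open>
  The entry \<open>0\<close> occurs twice in the sum: conjugated at \<open>j = 0\<close> and, through the translation, at
  \<open>j = p\<close>.  Both occurrences meet in one summand only for \<open>p = 0\<close>, which is where the quadratic
  term comes from.
\<close>

lemma ambiguity_perturb_origin:
  fixes s :: real
  assumes "N \<ge> 1" "p \<in> residue_set N"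
  shows "ambiguity N (p, l) (perturb z 0 (of_real s)) =
    ambiguity N (p, l) z + of_real s * ambiguity_slope N (p, l) z
      + of_real (s\<^sup>2) * (if p = 0 then 1 else 0)"
proof -
  define w where "w j = unit_root N powi (l * j)" for j :: int
  define y where "y j = z ((j - p) mod int N)" for j
  let ?R = "residue_set N"
  have R: "finite ?R" "0 \<in> ?R" using assms by (auto simp: residue_set_def)
  have "ambiguity N (p, l) (perturb z 0 (of_real s)) =
      (\<Sum>j\<in>?R. (cnj (z j) + (if j = 0 then of_real s else 0))
         * (w j * (y j + (if j = p then of_real s else 0))))"
    unfolding ambiguity_def hermitian_product_def time_freq_shift_def modulation_def
      translation_def perturb_def w_def y_def
    by (intro sum.cong refl) (auto simp: residue_shift_eq_zero_iff[OF assms])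
  also have "\<dots> = (\<Sum>j\<in>?R. cnj (z j) * (w j * y j)
       + (if j = 0 then of_real s * (w j * y j) else 0)
       + (if j = p then cnj (z j) * (w j * of_real s) else 0)
       + (if j = 0 then if j = p then of_real s * (w j * of_real s) else 0 else 0))"
    by (intro sum.cong refl) (auto simp: algebra_simps)
  also have "\<dots> = (\<Sum>j\<in>?R. cnj (z j) * (w j * y j)) + of_real s * (w 0 * y 0)
      + cnj (z p) * (w p * of_real s) + (if 0 = p then of_real s * (w 0 * of_real s) else 0)"
    using R assms(2) by (simp add: sum.distrib)
  finally show ?thesis
    by (auto simp: ambiguity_def hermitian_product_def time_freq_shift_def modulation_def
        translation_def ambiguity_slope_def w_def y_def algebra_simps power2_eq_square)
qed

lemma ambiguity_slope_perturb:
  fixes s :: real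
  shows "ambiguity_slope N (p, l) (perturb z p (of_real s * d)) =
    ambiguity_slope N (p, l) z
      + of_real s * ((if (- p) mod int N = p then d else 0) + unit_root N powi (l * p) * cnj d)"
  by (auto simp: ambiguity_slope_def perturb_def algebra_simps)

text \<open>
  With \<open>\<kappa> = [Q]\<close> the two candidates are \<open>\<kappa> + c\<close> and \<open>\<i> (\<kappa> - c)\<close>; if both vanished,
  then \<open>c = \<kappa> = - c\<close>, so \<open>c = 0\<close>.
\<close>

lemma exists_real_direction:
  fixes c :: complex
  assumes "c \<noteq> 0"
  shows "\<exists>b. (if Q then (if b then 1 else \<i>) else 0) + c * cnj (if b then 1 else \<i>) \<noteq> 0"
proof (rule ccontr)
  assume "\<not> ?thesis"
  then have *: "(if Q then (if b then 1 else \<i>) else 0) + c * cnj (if b then 1 else \<i>) = 0" for b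
    by blast
  have "(if Q then 1 else 0) + c = 0" using *[of True] by (cases Q) simp_all
  moreover have "\<i> * ((if Q then 1 else 0) - c) = 0"
    using *[of False] by (cases Q) (simp_all add: algebra_simps)
  ultimately show False using assms by (cases Q) auto
qed

section \<open>Independent Gaussian coordinates\<close>

definition complex_vector :: "(int \<times> bool \<Rightarrow> real) \<Rightarrow> int \<Rightarrow> complex" where
  "complex_vector x j = of_real (x (j, True)) + \<i> * of_real (x (j, False))"

lemma complex_vector_upd:
  "complex_vector (x((k, b) := t)) =
     perturb (complex_vector x) k (of_real (t - x (k, b)) * (if b then 1 else \<i>))"
  by (auto simp: complex_vector_def perturb_def fun_eq_iff algebra_simps)

abbreviation gaussian_coordinates :: "nat \<Rightarrow> (int \<times> bool \<Rightarrow> real) measure" where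
  "gaussian_coordinates N \<equiv> PiM (residue_set N \<times> UNIV) (\<lambda>_. std_gaussian)"

lemma measurable_complex_vector [measurable]:
  assumes "j \<in> residue_set N"
  shows "(\<lambda>x. complex_vector x j) \<in> borel_measurable (gaussian_coordinates N)"
proof -
  have [measurable]: "(\<lambda>x. x (j, b)) \<in> borel_measurable (gaussian_coordinates N)" for b
    using measurable_component_singleton[of "(j, b)" "residue_set N \<times> UNIV" "\<lambda>_. std_gaussian"] assms
    by (simp add: measurable_cong_sets[OF refl sets_std_gaussian])
  show ?thesis unfolding complex_vector_def by measurable
qed

lemma borel_measurable_cnj:
  "f \<in> borel_measurable A \<Longrightarrow> (\<lambda>x. cnj (f x)) \<in> borel_measurable A"
  by (rule measurable_compose[where g = cnj])
    (auto intro!: borel_measurable_continuous_onI continuous_intros)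

lemma mod_in_residue_set: "N \<ge> 1 \<Longrightarrow> a mod int N \<in> residue_set N"
  by (simp add: residue_set_def)

lemma measurable_ambiguity:
  assumes "N \<ge> 1"
  shows "(\<lambda>x. ambiguity N lam (complex_vector x)) \<in> borel_measurable (gaussian_coordinates N)"
  unfolding ambiguity_def hermitian_product_def time_freq_shift_def modulation_def translation_def
  by (intro borel_measurable_sum borel_measurable_times borel_measurable_const
      borel_measurable_cnj measurable_complex_vector mod_in_residue_set assms) auto

lemma measurable_ambiguity_slope:
  assumes "N \<ge> 1" "fst lam \<in> residue_set N"
  shows "(\<lambda>x. ambiguity_slope N lam (complex_vector x)) \<in> borel_measurable (gaussian_coordinates N)"
  unfolding ambiguity_slope_def
  by (intro borel_measurable_add borel_measurable_times borel_measurable_const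
      borel_measurable_cnj measurable_complex_vector mod_in_residue_set assms)

text \<open>
  One step of the argument: an almost sure statement about a function \<open>f\<close> of degree at most two
  in the coordinate \<open>(k, b)\<close> is reduced to one about its higher coefficients.  It serves twice,
  for the quadratic ambiguity function and for its real-linear slope.
\<close>

lemma AE_gaussian_coordinates_resample:
  fixes f :: "(int \<Rightarrow> complex) \<Rightarrow> complex"
  assumes "k \<in> residue_set N"
    and meas [measurable]: "(\<lambda>x. f (complex_vector x)) \<in> borel_measurable (gaussian_coordinates N)"
    and expand: "\<And>z s. f (perturb z k (of_real s * (if b then 1 else \<i>))) =
          f z + of_real s * B z + of_real (s\<^sup>2) * C"
    and ae: "AE x in gaussian_coordinates N. B (complex_vector x) \<noteq> 0 \<or> C \<noteq> 0"
  shows "AE x in gaussian_coordinates N. f (complex_vector x) \<noteq> 0"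
proof -
  interpret product_prob_space "\<lambda>_ :: int \<times> bool. std_gaussian" "residue_set N \<times> UNIV"
    by (intro product_prob_spaceI prob_space_std_gaussian)
  show ?thesis
  proof (rule AE_PiM_resample[where k = "(k, b)" and P = "\<lambda>x. f (complex_vector x) \<noteq> 0"])
    show "finite (residue_set N \<times> (UNIV :: bool set))" by (simp add: residue_set_def)
    show "(k, b) \<in> residue_set N \<times> UNIV" using assms(1) by simp
    show "{x \<in> space (gaussian_coordinates N). f (complex_vector x) \<noteq> 0}
        \<in> sets (gaussian_coordinates N)" by measurable
    show "AE x in gaussian_coordinates N. AE t in std_gaussian.
        f (complex_vector (x((k, b) := t))) \<noteq> 0"
      using ae
    proof (rule eventually_mono)
      fix x assume "B (complex_vector x) \<noteq> 0 \<or> C \<noteq> 0"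
      then show "AE t in std_gaussian. f (complex_vector (x((k, b) := t))) \<noteq> 0"
        unfolding complex_vector_upd expand by (rule AE_std_gaussian_quadratic_nonzero)
    qed
  qed
qed

lemma AE_ambiguity_slope_nonzero:
  assumes "N \<ge> 1" "p \<in> residue_set N"
  shows "AE x in gaussian_coordinates N. ambiguity_slope N (p, l) (complex_vector x) \<noteq> 0"
proof -
  obtain b where b: "(if (- p) mod int N = p then (if b then 1 else \<i>) else 0)
      + unit_root N powi (l * p) * cnj (if b then 1 else \<i>) \<noteq> 0"
    using exists_real_direction[OF unit_root_powi_nonzero] by blast
  show ?thesis
  proof (rule AE_gaussian_coordinates_resample[where k = p and b = b and C = 0])
    show "ambiguity_slope N (p, l) (perturb z p (of_real s * (if b then 1 else \<i>))) =
        ambiguity_slope N (p, l) z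
        + of_real s * ((if (- p) mod int N = p then (if b then 1 else \<i>) else 0)
            + unit_root N powi (l * p) * cnj (if b then 1 else \<i>))
        + of_real (s\<^sup>2) * 0" for z s
      by (simp only: ambiguity_slope_perturb mult_zero_right add_0_right)
  qed (use assms b in \<open>simp_all add: measurable_ambiguity_slope\<close>)
qed

lemma AE_ambiguity_nonzero:
  assumes "N \<ge> 1" "p \<in> residue_set N"
  shows "AE x in gaussian_coordinates N. ambiguity N (p, l) (complex_vector x) \<noteq> 0"
proof (rule AE_gaussian_coordinates_resample[where k = 0 and b = True])
  show "0 \<in> residue_set N" using assms by (simp add: residue_set_def)
  show "ambiguity N (p, l) (perturb z 0 (of_real s * (if True then 1 else \<i>))) =
      ambiguity N (p, l) z + of_real s * ambiguity_slope N (p, l) z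
        + of_real (s\<^sup>2) * (if p = 0 then 1 else 0)" for z s
    using ambiguity_perturb_origin[OF assms] by simp
  show "AE x in gaussian_coordinates N.
      ambiguity_slope N (p, l) (complex_vector x) \<noteq> 0 \<or> (if p = 0 then 1 else 0 :: complex) \<noteq> 0"
    using AE_ambiguity_slope_nonzero[OF assms, of l] by (rule AE_mp) simp
qed (rule measurable_ambiguity[OF assms(1)])

text \<open>
  Only the law of the coordinates enters the conclusion, so everything can be computed on the
  concrete product space.
\<close>

lemma distr_real_coordinates:
  assumes "prob_space M" "N \<ge> 1" "complex_std_normal_vector M N g"
  defines "X \<equiv> \<lambda>\<xi>. \<lambda>i\<in>residue_set N \<times> UNIV. real_coordinate i (g \<xi>)"
  shows "X \<in> M \<rightarrow>\<^sub>M gaussian_coordinates N" "distr M (gaussian_coordinates N) X = gaussian_coordinates N"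
proof -
  interpret prob_space M by fact
  let ?I = "residue_set N \<times> (UNIV :: bool set)"
  have ind: "indep_vars (\<lambda>_. borel) (\<lambda>i \<xi>. real_coordinate i (g \<xi>)) ?I"
    and D: "\<And>i. i \<in> ?I \<Longrightarrow> distributed M lborel (\<lambda>\<xi>. real_coordinate i (g \<xi>)) std_normal_density"
    using assms(3) unfolding complex_std_normal_vector_def by auto
  have rv: "(\<lambda>\<xi>. real_coordinate i (g \<xi>)) \<in> borel_measurable M" if "i \<in> ?I" for i
    using distributed_measurable[OF D[OF that]] by simp
  have law: "distr M borel (\<lambda>\<xi>. real_coordinate i (g \<xi>)) = std_gaussian" if "i \<in> ?I" for i
    using distributed_distr_eq_density[OF D[OF that]]
    by (simp add: std_gaussian_def cong: distr_cong)
  have sets: "sets (PiM ?I (\<lambda>_. borel)) = sets (gaussian_coordinates N)"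
    by (intro sets_PiM_cong) simp_all
  show "X \<in> M \<rightarrow>\<^sub>M gaussian_coordinates N"
    unfolding X_def using rv
    by (intro measurable_restrict) (simp add: measurable_cong_sets[OF refl sets_std_gaussian])
  have "?I \<noteq> {}" using assms(2) by (auto simp: residue_set_def)
  then have "distr M (PiM ?I (\<lambda>_. borel)) X
      = PiM ?I (\<lambda>i. distr M borel (\<lambda>\<xi>. real_coordinate i (g \<xi>)))"
    unfolding X_def using rv ind by (subst (asm) indep_vars_iff_distr_eq_PiM')
  also have "\<dots> = gaussian_coordinates N"
    using law by (intro PiM_cong) auto
  finally show "distr M (gaussian_coordinates N) X = gaussian_coordinates N"
    using distr_cong[OF refl sets, of M X X] by simp
qed

lemma ambiguity_complex_vector_real_coordinates:
  assumes "N \<ge> 1"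
  shows "ambiguity N lam (complex_vector (\<lambda>i\<in>residue_set N \<times> UNIV. real_coordinate i z))
    = ambiguity N lam z"
proof -
  have "complex_vector (\<lambda>i\<in>residue_set N \<times> UNIV. real_coordinate i z) j = z j"
    if "j \<in> residue_set N" for j
    using that by (simp add: complex_vector_def real_coordinate_def complex_eq_iff)
  then show ?thesis
    unfolding ambiguity_def hermitian_product_def time_freq_shift_def modulation_def
      translation_def
    by (intro sum.cong refl) (simp add: mod_in_residue_set[OF assms])
qed

theorem proposition2p1:
  fixes M :: "'a measure" and N :: nat and g :: "'a \<Rightarrow> int \<Rightarrow> complex"
  assumes "prob_space M"
    and "N \<ge> 1"
    and "complex_std_normal_vector M N g"
  shows "AE \<xi> in M. \<forall>lam \<in> residue_set N \<times> residue_set N.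
           hermitian_product N (g \<xi>) (time_freq_shift N lam (g \<xi>)) \<noteq> 0"
proof (rule AE_finite_allI)
  show "finite (residue_set N \<times> residue_set N)" by (simp add: residue_set_def)
next
  fix lam assume "lam \<in> residue_set N \<times> residue_set N"
  then obtain p l where lam: "lam = (p, l)" "p \<in> residue_set N" by blast
  define X where "X = (\<lambda>\<xi>. \<lambda>i\<in>residue_set N \<times> UNIV. real_coordinate i (g \<xi>))"
  note X = distr_real_coordinates[OF assms, folded X_def]
  note [measurable] = measurable_ambiguity[OF assms(2)]
  have "AE x in distr M (gaussian_coordinates N) X. ambiguity N lam (complex_vector x) \<noteq> 0"
    unfolding X(2) lam(1) by (rule AE_ambiguity_nonzero[OF assms(2) lam(2)])
  then have "AE \<xi> in M. ambiguity N lam (complex_vector (X \<xi>)) \<noteq> 0"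
    by (subst (asm) AE_distr_iff[OF X(1)]) measurable
  then show "AE \<xi> in M. hermitian_product N (g \<xi>) (time_freq_shift N lam (g \<xi>)) \<noteq> 0"
    unfolding X_def ambiguity_complex_vector_real_coordinates[OF assms(2)]
    by (simp add: ambiguity_def)
qed

end
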